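(* Let $n\ge 1$, let $\mathbb{H}^n$ be $\mathbb{R}^n$ or $\mathbb{C}^n$, let $x=(a_1,a_2,\ldots,a_n)\in\mathbb{H}^n$ be nonzero, and let $c_x\ge 0$ be a real number. The following are equivalent: (1) $\|x\|_1=\left(1-\frac{c_x}{2}\right)\sqrt{n}\,\|x\|_2$. (2) $\sum_{i=1}^n\left|\frac{|a_i|}{\|x\|_2}-\frac{1}{\sqrt n}\right|^2=c_x$. (3) The infimum of the $\ell_2$-distance from $\frac{x}{\|x\|_2}$ to the constant modulus vectors of $\mathbb{H}^n$ is $\sqrt{c_x}$. In particular, if $c_x$ is the number satisfying these equivalent conditions, then for every real $s\ge 0$, \[\|x\|_1\le\sqrt{s}\,\|x\|_2\] if and only if \[\left(1-\frac{c_x}{2}\right)\sqrt n\le\sqrt s,\] if and only if \[1-\frac{c_x}{2}\le\sqrt{\frac{s}{n}}.\]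
   Context: $\mathbb{H}^n$ denotes the $n$-dimensional real or complex Hilbert space $\mathbb{R}^n$ or $\mathbb{C}^n$ with its standard inner product. For $x=(a_1,\ldots,a_n)\in\mathbb{H}^n$, $\|x\|_1=\sum_{i=1}^n|a_i|$ and $\|x\|_2=\left(\sum_{i=1}^n|a_i|^2\right)^{1/2}$. A constant modulus vector in $\mathbb{H}^n$ is a vector of the form $\frac{1}{\sqrt n}(c_1,c_2,\ldots,c_n)$, where the $c_i$ are scalars of $\mathbb{H}$ (real, respectively complex) with $|c_i|=1$ for all $i=1,\ldots,n$. *)

theory Defs
  imports "HOL-Analysis.Analysis"
begin

text \<open>
  The space H^n is rendered as \<open>real ^ 'n\<close> or \<open>complex ^ 'n\<close> with \<open>n = CARD('n)\<close>. The library's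
  \<open>norm\<close> and \<open>dist\<close> on these types are the \<open>\<ell>\<^sub>2\<close>-norm and the \<open>\<ell>\<^sub>2\<close>-distance. The definitions below
  are used only for the scalar types \<open>real\<close> and \<open>complex\<close>, where \<open>norm\<close> of a scalar is its
  absolute value.
\<close>

definition l1_norm :: "'a::real_normed_field ^ 'n::finite \<Rightarrow> real" where
  "l1_norm x = (\<Sum>i\<in>UNIV. norm (x $ i))"

definition constant_modulus_vectors :: "('a::real_normed_field ^ 'n::finite) set" where
  "constant_modulus_vectors =
     {(1 / sqrt (real CARD('n))) *\<^sub>R u | u. \<forall>i. norm (u $ i) = 1}"

end

theory Submission
  imports Defs
begin

text \<open>
  Expanding the square gives \<open>\<Sum>\<^sub>i (\<bar>a\<^sub>i\<bar> / \<parallel>x\<parallel>\<^sub>2 - 1 / \<surd>n)\<^sup>2 = 2 - 2 \<parallel>x\<parallel>\<^sub>1 / (\<surd>n \<parallel>x\<parallel>\<^sub>2)\<close>, which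
  links (1) and (2). For (3), the reverse triangle inequality in each coordinate shows that no
  constant modulus vector is closer to a given vector than the one with the same phases.
\<close>

lemma sum_norm_power2_vec:
  fixes x :: "'a::real_normed_field ^ 'n::finite"
  shows "(\<Sum>i\<in>UNIV. (norm (x $ i))\<^sup>2) = (norm x)\<^sup>2"
  by (simp add: norm_vec_def L2_set_def sum_nonneg)

text \<open>The infimum is attained, so it suffices to show that the claimed value is itself one of
  the distances and bounds all of them from below. Here \<open>y\<close> is arbitrary; it becomes
  the normalized vector when the lemma is applied.\<close>

lemma Inf_dist_constant_modulus_vectors:
  fixes y :: "'a::real_normed_field ^ 'n::finite"
  shows "(INF v\<in>constant_modulus_vectors. dist y v) =
    sqrt (\<Sum>i\<in>UNIV. \<bar>norm (y $ i) - 1 / sqrt (real CARD('n))\<bar>\<^sup>2)"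
proof (rule cInf_eq_minimum)
  define r where "r = 1 / sqrt (real CARD('n))"
  have r: "r \<ge> 0" by (simp add: r_def)
  \<comment> \<open>The coordinates of \<open>u\<close> are the phases of \<open>y\<close>. A zero
    coordinate has no phase; any scalar of modulus one works there, because the distance from 0 to
    \<open>r *\<^sub>R u $ i\<close> is \<open>r\<close> regardless.\<close>
  define u :: "'a ^ 'n" where
    "u = (\<chi> i. if y $ i = 0 then 1 else (1 / norm (y $ i)) *\<^sub>R (y $ i))"
  have "r *\<^sub>R u \<in> constant_modulus_vectors"
    unfolding constant_modulus_vectors_def r_def by (auto simp: u_def)
  moreover have "norm (y $ i - (r *\<^sub>R u) $ i) = \<bar>norm (y $ i) - r\<bar>" for i
  proof (cases "y $ i = 0")
    case True
    then show ?thesis by (simp add: u_def)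
  next
    case False
    \<comment> \<open>Both coordinates lie on the same real ray through \<open>y $ i\<close>, so
      their difference is a real multiple of it and its norm reduces to an absolute value of
      reals.\<close>
    then have "y $ i - (r *\<^sub>R u) $ i = (1 - r / norm (y $ i)) *\<^sub>R (y $ i)"
      by (simp add: u_def algebra_simps)
    then have "norm (y $ i - (r *\<^sub>R u) $ i) = \<bar>(1 - r / norm (y $ i)) * norm (y $ i)\<bar>"
      by (simp add: abs_mult)
    with False show ?thesis by (simp add: algebra_simps)
  qed
  ultimately show "sqrt (\<Sum>i\<in>UNIV. \<bar>norm (y $ i) - 1 / sqrt (real CARD('n))\<bar>\<^sup>2)
      \<in> dist y ` constant_modulus_vectors"
    by (intro image_eqI[of _ _ "r *\<^sub>R u"])
       (simp_all add: dist_norm norm_vec_def L2_set_def flip: r_def)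
next
  fix d assume "d \<in> dist y ` constant_modulus_vectors"
  then obtain u where d: "d = dist y ((1 / sqrt (real CARD('n))) *\<^sub>R u)"
    and u: "\<And>i. norm (u $ i) = 1"
    by (auto simp: constant_modulus_vectors_def)
  \<comment> \<open>Reverse triangle inequality, where the subtracted coordinate has norm exactly
    \<open>1 / sqrt n\<close> because \<open>u $ i\<close> has modulus one.\<close>
  have "\<bar>norm (y $ i) - 1 / sqrt (real CARD('n))\<bar>
      \<le> norm ((y - (1 / sqrt (real CARD('n))) *\<^sub>R u) $ i)" for i
    using norm_triangle_ineq3[of "y $ i" "(1 / sqrt (real CARD('n))) *\<^sub>R u $ i"] u[of i] by simp
  then show "sqrt (\<Sum>i\<in>UNIV. \<bar>norm (y $ i) - 1 / sqrt (real CARD('n))\<bar>\<^sup>2) \<le> d"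
    unfolding d dist_norm norm_vec_def L2_set_def
    by (intro real_sqrt_le_mono sum_mono power_mono) auto
qed

lemma sum_normalized_deviation:
  fixes x :: "'a::real_normed_field ^ 'n::finite"
  assumes "x \<noteq> 0"
  shows "(\<Sum>i\<in>UNIV. \<bar>norm (x $ i) / norm x - 1 / sqrt (real CARD('n))\<bar>\<^sup>2) =
    2 - 2 * l1_norm x / (sqrt (real CARD('n)) * norm x)"
proof -
  have "(\<Sum>i\<in>UNIV. \<bar>norm (x $ i) / norm x - 1 / sqrt (real CARD('n))\<bar>\<^sup>2) =
     (\<Sum>i\<in>UNIV. (norm (x $ i))\<^sup>2 / (norm x)\<^sup>2 + 1 / real CARD('n)
       - 2 / (sqrt (real CARD('n)) * norm x) * norm (x $ i))"
    by (intro sum.cong refl) (simp add: power2_diff power_divide mult_ac)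
  \<comment> \<open>The \<open>n\<close> copies of \<open>1 / n\<close> add up to 1, and the cross
    terms collect into the \<open>l1_norm\<close>. The first quotient becomes 1 once
    \<open>x \<noteq> 0\<close> is used.\<close>
  also have "\<dots> = (norm x)\<^sup>2 / (norm x)\<^sup>2 + 1 - 2 / (sqrt (real CARD('n)) * norm x) * l1_norm x"
    by (simp add: sum.distrib sum_subtractf l1_norm_def sum_norm_power2_vec
        flip: sum_divide_distrib sum_distrib_left)
  finally show ?thesis using assms by simp
qed

lemma l1_norm_constant_modulus_equivalences:
  fixes x :: "'a::real_normed_field ^ 'n::finite" and c :: real
  assumes "x \<noteq> 0"
  shows "l1_norm x = (1 - c / 2) * sqrt (real CARD('n)) * norm x \<longleftrightarrow>
      (\<Sum>i\<in>UNIV. \<bar>norm (x $ i) / norm x - 1 / sqrt (real CARD('n))\<bar>\<^sup>2) = c"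
    and "(\<Sum>i\<in>UNIV. \<bar>norm (x $ i) / norm x - 1 / sqrt (real CARD('n))\<bar>\<^sup>2) = c \<longleftrightarrow>
      (INF v\<in>constant_modulus_vectors. dist (x /\<^sub>R norm x) v) = sqrt c"
proof -
  \<comment> \<open>The link between (1) and (2) is this linear equation solved for
    \<open>c\<close>, with \<open>p = sqrt n * norm x\<close>.\<close>
  have "l = (1 - c / 2) * p \<longleftrightarrow> 2 - 2 * l / p = c" if "p > 0" for l p :: real
    using that by (auto simp: field_simps)
  from this[of "sqrt (real CARD('n)) * norm x" "l1_norm x"]
  show "l1_norm x = (1 - c / 2) * sqrt (real CARD('n)) * norm x \<longleftrightarrow>
      (\<Sum>i\<in>UNIV. \<bar>norm (x $ i) / norm x - 1 / sqrt (real CARD('n))\<bar>\<^sup>2) = c"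
    unfolding sum_normalized_deviation[OF assms] using assms by (simp add: mult.assoc)
  \<comment> \<open>The coordinates of the normalized vector have modulus
    \<open>norm (x $ i) / norm x\<close>, so the infimum is the square root of the left-hand sum,
    and \<open>sqrt\<close> is injective.\<close>
  show "(\<Sum>i\<in>UNIV. \<bar>norm (x $ i) / norm x - 1 / sqrt (real CARD('n))\<bar>\<^sup>2) = c \<longleftrightarrow>
      (INF v\<in>constant_modulus_vectors. dist (x /\<^sub>R norm x) v) = sqrt c"
    by (simp add: Inf_dist_constant_modulus_vectors divide_inverse_commute)
qed

lemma l1_norm_le_iff:
  fixes x :: "'a::real_normed_field ^ 'n::finite" and c s :: real
  assumes "x \<noteq> 0" "l1_norm x = (1 - c / 2) * sqrt (real CARD('n)) * norm x"
  shows "l1_norm x \<le> sqrt s * norm x \<longleftrightarrow> (1 - c / 2) * sqrt (real CARD('n)) \<le> sqrt s"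
  using assms by simp

lemma mult_sqrt_card_le_iff:
  "a * sqrt (real CARD('n::finite)) \<le> sqrt s \<longleftrightarrow> a \<le> sqrt (s / real CARD('n))"
  by (simp add: real_sqrt_divide pos_le_divide_eq)

theorem theorem2p2:
  fixes c :: real
  assumes "c \<ge> 0"
  shows
    "(\<forall>x :: real ^ 'n. x \<noteq> 0 \<longrightarrow>
       ((l1_norm x = (1 - c / 2) * sqrt (real CARD('n)) * norm x) \<longleftrightarrow>
        (\<Sum>i\<in>UNIV. \<bar>norm (x $ i) / norm x - 1 / sqrt (real CARD('n))\<bar>\<^sup>2) = c)
     \<and> ((\<Sum>i\<in>UNIV. \<bar>norm (x $ i) / norm x - 1 / sqrt (real CARD('n))\<bar>\<^sup>2) = c \<longleftrightarrow>
        (INF v\<in>constant_modulus_vectors. dist (x /\<^sub>R norm x) v) = sqrt c)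
     \<and> (l1_norm x = (1 - c / 2) * sqrt (real CARD('n)) * norm x \<longrightarrow>
        (\<forall>s::real. s \<ge> 0 \<longrightarrow>
            (l1_norm x \<le> sqrt s * norm x \<longleftrightarrow> (1 - c / 2) * sqrt (real CARD('n)) \<le> sqrt s)
          \<and> ((1 - c / 2) * sqrt (real CARD('n)) \<le> sqrt s \<longleftrightarrow> 1 - c / 2 \<le> sqrt (s / real CARD('n))))))
   \<and>
     (\<forall>x :: complex ^ 'n. x \<noteq> 0 \<longrightarrow>
       ((l1_norm x = (1 - c / 2) * sqrt (real CARD('n)) * norm x) \<longleftrightarrow>
        (\<Sum>i\<in>UNIV. \<bar>norm (x $ i) / norm x - 1 / sqrt (real CARD('n))\<bar>\<^sup>2) = c)
     \<and> ((\<Sum>i\<in>UNIV. \<bar>norm (x $ i) / norm x - 1 / sqrt (real CARD('n))\<bar>\<^sup>2) = c \<longleftrightarrow>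
        (INF v\<in>constant_modulus_vectors. dist (x /\<^sub>R norm x) v) = sqrt c)
     \<and> (l1_norm x = (1 - c / 2) * sqrt (real CARD('n)) * norm x \<longrightarrow>
        (\<forall>s::real. s \<ge> 0 \<longrightarrow>
            (l1_norm x \<le> sqrt s * norm x \<longleftrightarrow> (1 - c / 2) * sqrt (real CARD('n)) \<le> sqrt s)
          \<and> ((1 - c / 2) * sqrt (real CARD('n)) \<le> sqrt s \<longleftrightarrow> 1 - c / 2 \<le> sqrt (s / real CARD('n))))))"
  \<comment> \<open>The real and the complex half are two instances of the same lemmas, which hold
    over any \<open>real_normed_field\<close>.\<close>
  by (intro conjI allI impI l1_norm_constant_modulus_equivalences l1_norm_le_iff
      mult_sqrt_card_le_iff)

end
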